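(* Let $S,A$ be nonempty finite sets and let $T\subseteq S\triangleright A$ be a class of policies containing all deterministic policies. Then a policy $\pi\in T$ is deterministic if and only if it is $T$-teleo-specifiable, i.e. if and only if there exists a teleo-environment $\varepsilon\in A\triangleright(S\times G)$ such that for every $\pi'\in T$, $\mathcal{S}(\pi',\varepsilon)\ge\mathcal{S}(\pi,\varepsilon)$ implies $\pi'=\pi$.
   Context: For a finite set $X$, $P(X)$ is the set of probability distributions on $X$ and $\mathrm{supp}(p)$ is the support of $p\in P(X)$. For finite sets $I$ (inputs) and $O$ (outputs), the set $I \triangleright O$ of transducers is defined coinductively (it is the final coalgebra of $X \mapsto \sum_{p \in P(O)} (I \times \mathrm{supp}(p) \to X)$): a transducer $\pi$ is a pair $(\mathbb{P}_\pi, \mathbb{T}_\pi)$ with $\mathbb{P}_\pi \in P(O)$ and $\mathbb{T}_\pi : I \times \mathrm{supp}(\mathbb{P}_\pi) \to I \triangleright O$. Deterministic transducers are defined coinductively: $\pi$ is deterministic if $\mathbb{P}_\pi$ is a one-point distribution and $\mathbb{T}_\pi$ takes values in deterministic transducers. Let $G = \{\bot,\top\}$ ($\top$ = success). A policy is an element of $S\triangleright A$; a teleo-environment is an element of $A \triangleright (S\times G)$. The success probability $\mathcal{S}(\pi,\varepsilon)$ (the probability that $\top$ is emitted at least once when $\pi$ and $\varepsilon$ are coupled) is $\lim_{n\to\infty} \mathcal{S}_n(\pi,\varepsilon)$, where $\mathcal{S}_0(\pi,\varepsilon) = \sum_{s\in S} \mathbb{P}_\varepsilon(s,\top)$ and $\mathcal{S}_{n+1}(\pi,\varepsilon)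 = \sum_{s\in S}\sum_{a\in A} \left[\mathbb{P}_\pi(a)\mathbb{P}_\varepsilon(s,\top) + \mathbb{P}_\pi(a)\mathbb{P}_\varepsilon(s,\bot)\, \mathcal{S}_n\big(\mathbb{T}_\pi(s,a), \mathbb{T}_\varepsilon(a,(s,\bot))\big)\right]$ (terms with zero coefficient are omitted). *)

theory Defs
  imports "HOL-Probability.Probability_Mass_Function"
begin

text \<open>
  Finite input and output sets are types of class \<open>finite\<close>.  The dependent transition function
  \<open>\<T>\<^sub>\<pi> : I \<times> supp \<P>\<^sub>\<pi> \<rightarrow> I \<triangleright> O\<close> is represented by a partial map whose domain is exactly
  \<open>UNIV \<times> set_pmf \<P>\<^sub>\<pi>\<close>.  The domain condition is imposed hereditarily by \<open>transducers\<close>; thus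
  \<open>I \<triangleright> O\<close> is the set \<open>transducers :: ('i, 'o) transducer set\<close>, and equality on it is equality
  in the final coalgebra (nothing is recorded outside the support).
\<close>

codatatype ('i, 'o) transducer =
  Transducer (emit: "'o pmf") (step: "'i \<times> 'o \<Rightarrow> ('i, 'o) transducer option")

coinductive_set transducers :: "('i, 'o) transducer set" where
  "dom (step \<pi>) = UNIV \<times> set_pmf (emit \<pi>) \<Longrightarrow>
   \<forall>\<pi>' \<in> ran (step \<pi>). \<pi>' \<in> transducers \<Longrightarrow>
   \<pi> \<in> transducers"

coinductive deterministic :: "('i, 'o) transducer \<Rightarrow> bool" where
  "\<exists>y. emit \<pi> = return_pmf y \<Longrightarrow>
   \<forall>\<pi>' \<in> ran (step \<pi>). deterministic \<pi>' \<Longrightarrow>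
   deterministic \<pi>"

text \<open>\<open>G = {\<bottom>, \<top>}\<close> is \<^typ>\<open>bool\<close>, with \<^const>\<open>True\<close> for success.\<close>

type_synonym ('s, 'a) policy = "('s, 'a) transducer"
type_synonym ('s, 'a) teleo_env = "('a, 's \<times> bool) transducer"

text \<open>
  Outside its domain the partial map \<open>step\<close> is read through \<open>the\<close>; for members of
  \<open>transducers\<close> this happens only in terms whose coefficient is zero.
\<close>

primrec success_upto ::
  "nat \<Rightarrow> ('s::finite, 'a::finite) policy \<Rightarrow> ('s, 'a) teleo_env \<Rightarrow> real" where
  "success_upto 0 \<pi> \<epsilon> = (\<Sum>s\<in>UNIV. pmf (emit \<epsilon>) (s, True))"
| "success_upto (Suc n) \<pi> \<epsilon> = (\<Sum>s\<in>UNIV. \<Sum>a\<in>UNIV.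
     pmf (emit \<pi>) a * pmf (emit \<epsilon>) (s, True) +
     pmf (emit \<pi>) a * pmf (emit \<epsilon>) (s, False) *
       success_upto n (the (step \<pi> (s, a))) (the (step \<epsilon> (a, (s, False)))))"

definition success :: "('s::finite, 'a::finite) policy \<Rightarrow> ('s, 'a) teleo_env \<Rightarrow> real" where
  "success \<pi> \<epsilon> = lim (\<lambda>n. success_upto n \<pi> \<epsilon>)"

definition teleo_specifiable ::
  "('s::finite, 'a::finite) policy set \<Rightarrow> ('s, 'a) policy \<Rightarrow> bool" where
  "teleo_specifiable T \<pi> \<longleftrightarrow>
     (\<exists>\<epsilon> \<in> (transducers :: ('s, 'a) teleo_env set).
        \<forall>\<pi>' \<in> T. success \<pi>' \<epsilon> \<ge> success \<pi> \<epsilon> \<longrightarrow> \<pi>' = \<pi>)"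

text \<open>The limit defining \<^const>\<open>success\<close> exists.\<close>

lemma sum_pmf_UNIV: "(\<Sum>x\<in>UNIV. pmf p (x::'x::finite)) = 1"
  by (rule sum_pmf_eq_1) auto

lemma sum_pmf_signal:
  fixes p :: "('s::finite \<times> bool) pmf"
  shows "(\<Sum>s\<in>UNIV. pmf p (s, True)) + (\<Sum>s\<in>UNIV. pmf p (s, False)) = 1"
proof -
  have "1 = (\<Sum>x\<in>UNIV \<times> UNIV. pmf p x)"
    using sum_pmf_UNIV[of p] by simp
  also have "\<dots> = (\<Sum>s\<in>UNIV. \<Sum>g\<in>UNIV. pmf p (s, g))"
    by (simp only: sum.cartesian_product split_def prod.collapse)
  finally show ?thesis
    by (simp add: UNIV_bool sum.distrib)
qed

lemma success_upto_Suc_alt: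
  "success_upto (Suc n) \<pi> \<epsilon> = success_upto 0 \<pi> \<epsilon> + (\<Sum>s\<in>UNIV. \<Sum>a\<in>UNIV.
     pmf (emit \<pi>) a * pmf (emit \<epsilon>) (s, False) *
       success_upto n (the (step \<pi> (s, a))) (the (step \<epsilon> (a, (s, False)))))"
  by (simp add: sum.distrib sum_distrib_right[symmetric] sum_pmf_UNIV)

lemma success_upto_nonneg: "0 \<le> success_upto n \<pi> \<epsilon>"
  by (induction n arbitrary: \<pi> \<epsilon>) (auto intro!: sum_nonneg)

lemma success_upto_le_1: "success_upto n \<pi> \<epsilon> \<le> 1"
proof (induction n arbitrary: \<pi> \<epsilon>)
  case 0
  have "0 \<le> (\<Sum>s\<in>UNIV. pmf (emit \<epsilon>) (s, False))"
    by (simp add: sum_nonneg)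
  then show ?case
    using sum_pmf_signal[of "emit \<epsilon>"] by simp
next
  case (Suc n)
  have "(\<Sum>s\<in>UNIV. \<Sum>a\<in>UNIV. pmf (emit \<pi>) a * pmf (emit \<epsilon>) (s, False) *
          success_upto n (the (step \<pi> (s, a))) (the (step \<epsilon> (a, (s, False)))))
        \<le> (\<Sum>s\<in>UNIV. \<Sum>a\<in>UNIV. pmf (emit \<pi>) a * pmf (emit \<epsilon>) (s, False))"
    by (intro sum_mono mult_left_le Suc.IH) simp
  also have "\<dots> = (\<Sum>s\<in>UNIV. pmf (emit \<epsilon>) (s, False))"
    by (simp add: sum_distrib_right[symmetric] sum_pmf_UNIV)
  finally show ?case
    using sum_pmf_signal[of "emit \<epsilon>"] unfolding success_upto_Suc_alt by simp
qed

lemma success_upto_mono: "success_upto n \<pi> \<epsilon> \<le> success_upto (Suc n) \<pi> \<epsilon>"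
proof (induction n arbitrary: \<pi> \<epsilon>)
  case 0
  show ?case
    unfolding success_upto_Suc_alt
    by (simp del: success_upto.simps add: sum_nonneg success_upto_nonneg)
next
  case (Suc n)
  show ?case
    unfolding success_upto_Suc_alt[of "Suc n" \<pi> \<epsilon>] success_upto_Suc_alt[of n \<pi> \<epsilon>]
    by (intro add_left_mono sum_mono mult_left_mono Suc.IH) simp
qed

lemma success_upto_LIMSEQ: "(\<lambda>n. success_upto n \<pi> \<epsilon>) \<longlonglongrightarrow> success \<pi> \<epsilon>"
proof -
  have "Bseq (\<lambda>n. success_upto n \<pi> \<epsilon>)"
    by (rule BseqI'[where K = 1]) (simp add: success_upto_nonneg success_upto_le_1)
  moreover have "incseq (\<lambda>n. success_upto n \<pi> \<epsilon>)"
    by (rule incseq_SucI) (rule success_upto_mono)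
  ultimately have "convergent (\<lambda>n. success_upto n \<pi> \<epsilon>)"
    by (intro Bseq_monoseq_convergent incseq_imp_monoseq)
  then show ?thesis
    unfolding success_def by (simp add: convergent_LIMSEQ_iff)
qed

end

theory Submission
  imports Defs
begin

text \<open>
  If \<open>\<pi>\<close> is deterministic, let the environment send uniformly random signals in \<open>S \<times> G\<close> as long as
  the actions agree with \<open>\<pi>\<close>, and never succeed after the first disagreement.  Then \<open>\<pi>\<close> succeeds
  with probability 1, and every policy that can ever disagree with \<open>\<pi>\<close> does strictly worse.

  For the converse it suffices that every policy \<open>\<pi>\<close> is matched, in every environment, by some
  deterministic policy.  For a finite horizon this holds by choosing the best action at each step.
  So if it fails, no policy at all does better than \<open>\<pi>\<close>, that is, \<open>\<pi>\<close> is optimal, and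
  every action in its support preserves the optimal value.  A deterministic selection from the support
  could still postpone success forever.  To exclude this, choose weights \<open>c\<^sub>k\<close> with
  \<open>\<Sum>\<^sub>k c\<^sub>k = \<infinity>\<close> and \<open>\<Sum>\<^sub>k c\<^sub>k (\<S> - \<S>\<^sub>k) < \<infinity>\<close> along \<open>\<pi>\<close>, and select actions
  that do not increase the latter sum: its finiteness for the resulting policy forces the success
  probability of that policy to be \<open>\<S>\<close>.
\<close>

section \<open>Averages over finite distributions, and policies with a prescribed first
  action\<close>

definition signal :: "('s::finite, 'a) teleo_env \<Rightarrow> real" where
  "signal \<epsilon> = (\<Sum>s\<in>UNIV. pmf (emit \<epsilon>) (s, True))"

lemma sum_pmf_return:
  fixes f :: "'a::finite \<Rightarrow> real"
  shows "(\<Sum>b\<in>UNIV. pmf (return_pmf a) b * f b) = f a"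
  by (subst sum.remove[of _ a]) (auto simp: pmf_return intro!: sum.neutral)

text \<open>A minimizer of \<open>f\<close> on the support works. Values in \<open>ennreal\<close>
  admit infinite costs, and staying in the support is what later preserves optimality.\<close>

lemma exists_le_average:
  fixes f :: "'a::finite \<Rightarrow> ennreal"
  shows "\<exists>a\<in>set_pmf p. f a \<le> (\<Sum>b\<in>UNIV. ennreal (pmf p b) * f b)"
proof -
  obtain a where a: "a \<in> set_pmf p" "\<And>b. b \<in> set_pmf p \<Longrightarrow> f a \<le> f b"
    using ex_min_if_finite[of "f ` set_pmf p"] set_pmf_not_empty[of p]
    by (auto simp: not_less)
  have "f a = (\<Sum>b\<in>UNIV. ennreal (pmf p b)) * f a"
    by (simp add: sum_pmf_UNIV)
  also have "\<dots> = (\<Sum>b\<in>UNIV. ennreal (pmf p b) * f a)"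
    by (rule sum_distrib_right)
  also have "\<dots> \<le> (\<Sum>b\<in>UNIV. ennreal (pmf p b) * f b)"
  proof (rule sum_mono)
    fix b show "ennreal (pmf p b) * f a \<le> ennreal (pmf p b) * f b"
      using a(2)[of b] by (cases "b \<in> set_pmf p") (auto simp: set_pmf_iff intro: mult_left_mono)
  qed
  finally show ?thesis using a(1) by blast
qed

lemma exists_ge_average:
  fixes f :: "'a::finite \<Rightarrow> real"
  shows "\<exists>a. (\<Sum>b\<in>UNIV. pmf p b * f b) \<le> f a"
proof (rule ccontr)
  assume contra: "\<not> ?thesis"
  define M where "M = (\<Sum>b\<in>UNIV. pmf p b * f b)"
  have less: "f a < M" for a using contra by (simp add: not_le M_def)
  obtain a where "a \<in> set_pmf p" using set_pmf_not_empty by fast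
  then have "(\<Sum>b\<in>UNIV. pmf p b * f b) < (\<Sum>b\<in>UNIV. pmf p b * M)"
    using less
    by (intro sum_strict_mono_ex1) (auto intro!: mult_left_mono exI[of _ a] simp: less_imp_le pmf_positive)
  also have "\<dots> = M" by (simp add: sum_distrib_right[symmetric] sum_pmf_UNIV)
  finally show False by (simp add: M_def)
qed

text \<open>The step is \<open>None\<close> off \<open>a\<close>, as the domain condition of
  \<open>transducers\<close> demands. Competing policies are assembled by prefixing an action to
  chosen continuations.\<close>

definition act :: "'a \<Rightarrow> ('s \<Rightarrow> ('s, 'a) policy) \<Rightarrow> ('s, 'a) policy" where
  "act a \<rho> = Transducer (return_pmf a) (\<lambda>(s, b). if b = a then Some (\<rho> s) else None)"

lemma act_simps [simp]:
  "emit (act a \<rho>) = return_pmf a" "step (act a \<rho>) (s, a) = Some (\<rho> s)"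
  by (simp_all add: act_def)

lemma act_deterministic:
  assumes "\<And>s. \<rho> s \<in> transducers" "\<And>s. deterministic (\<rho> s)"
  shows "act a \<rho> \<in> transducers" "deterministic (act a \<rho>)"
proof -
  have dom: "dom (step (act a \<rho>)) = UNIV \<times> set_pmf (emit (act a \<rho>))"
    by (auto simp: act_def dom_def split: if_splits)
  have ran: "ran (step (act a \<rho>)) \<subseteq> range \<rho>"
    by (auto simp: act_def ran_def split: if_splits)
  show "act a \<rho> \<in> transducers"
    using ran assms(1) by (intro transducers.intros[OF dom]) blast
  show "deterministic (act a \<rho>)"
    using ran assms(2) by (intro deterministic.intros exI[of _ a]) auto
qed

section \<open>One-step equations for the success probability\<close>

lemma sum_emit_eq_average:
  "(\<Sum>s\<in>UNIV. \<Sum>a\<in>UNIV. pmf (emit \<pi>) a * pmf (emit \<epsilon>) (s, False) * f s a) =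
   (\<Sum>a\<in>UNIV. pmf (emit \<pi>) a * (\<Sum>s\<in>UNIV. pmf (emit \<epsilon>) (s, False) * f s a))"
  for \<pi> :: "('s::finite, 'a::finite) policy"
  by (subst sum.swap) (simp add: sum_distrib_left mult.assoc)

abbreviation succ :: "('s, 'a) policy \<Rightarrow> 's \<Rightarrow> 'a \<Rightarrow> ('s, 'a) policy" where
  "succ \<pi> s a \<equiv> the (step \<pi> (s, a))"

abbreviation succ_env :: "('s, 'a) teleo_env \<Rightarrow> 's \<Rightarrow> 'a \<Rightarrow> ('s, 'a) teleo_env" where
  "succ_env \<epsilon> s a \<equiv> the (step \<epsilon> (a, (s, False)))"

lemma success_upto_0: "success_upto 0 \<pi> \<epsilon> = signal \<epsilon>"
  by (simp add: signal_def)

lemma success_upto_Suc: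
  "success_upto (Suc n) \<pi> \<epsilon> = signal \<epsilon> + (\<Sum>a\<in>UNIV. pmf (emit \<pi>) a *
     (\<Sum>s\<in>UNIV. pmf (emit \<epsilon>) (s, False) * success_upto n (succ \<pi> s a) (succ_env \<epsilon> s a)))"
  by (simp only: success_upto_Suc_alt success_upto_0 sum_emit_eq_average)

declare success_upto.simps [simp del]

text \<open>Limit of \<open>success_upto_Suc\<close> as the horizon grows; the sums are finite, so
  the limit passes through them.\<close>

lemma success_unfold:
  "success \<pi> \<epsilon> = signal \<epsilon> + (\<Sum>a\<in>UNIV. pmf (emit \<pi>) a *
     (\<Sum>s\<in>UNIV. pmf (emit \<epsilon>) (s, False) * success (succ \<pi> s a) (succ_env \<epsilon> s a)))"
proof (rule LIMSEQ_unique)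
  show "(\<lambda>n. success_upto (Suc n) \<pi> \<epsilon>) \<longlonglongrightarrow> success \<pi> \<epsilon>"
    by (rule LIMSEQ_Suc) (rule success_upto_LIMSEQ)
  show "(\<lambda>n. success_upto (Suc n) \<pi> \<epsilon>) \<longlonglongrightarrow> signal \<epsilon> + (\<Sum>a\<in>UNIV. pmf (emit \<pi>) a *
     (\<Sum>s\<in>UNIV. pmf (emit \<epsilon>) (s, False) * success (succ \<pi> s a) (succ_env \<epsilon> s a)))"
    unfolding success_upto_Suc by (intro tendsto_intros success_upto_LIMSEQ)
qed

lemma success_upto_Suc_return:
  assumes "emit \<pi> = return_pmf a"
  shows "success_upto (Suc n) \<pi> \<epsilon> = signal \<epsilon> +
    (\<Sum>s\<in>UNIV. pmf (emit \<epsilon>) (s, False) * success_upto n (succ \<pi> s a) (succ_env \<epsilon> s a))"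
  by (simp add: success_upto_Suc assms sum_pmf_return)

lemma success_return:
  assumes "emit \<pi> = return_pmf a"
  shows "success \<pi> \<epsilon> = signal \<epsilon> +
    (\<Sum>s\<in>UNIV. pmf (emit \<epsilon>) (s, False) * success (succ \<pi> s a) (succ_env \<epsilon> s a))"
  by (subst success_unfold) (simp add: assms sum_pmf_return)

lemma success_upto_Suc_act:
  "success_upto (Suc n) (act a \<rho>) \<epsilon> = signal \<epsilon> +
    (\<Sum>s\<in>UNIV. pmf (emit \<epsilon>) (s, False) * success_upto n (\<rho> s) (succ_env \<epsilon> s a))"
  by (simp add: success_upto_Suc_return[of _ a])

lemma success_act:
  "success (act a \<rho>) \<epsilon> = signal \<epsilon> +
    (\<Sum>s\<in>UNIV. pmf (emit \<epsilon>) (s, False) * success (\<rho> s) (succ_env \<epsilon> s a))"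
  by (simp add: success_return[of "act a \<rho>" a])

lemma success_upto_le_success: "success_upto n \<pi> \<epsilon> \<le> success \<pi> \<epsilon>"
  by (intro incseq_le[OF _ success_upto_LIMSEQ] incseq_SucI success_upto_mono)

lemma success_le_1: "success \<pi> \<epsilon> \<le> 1"
  by (rule LIMSEQ_le_const2[OF success_upto_LIMSEQ]) (use success_upto_le_1 in blast)

section \<open>Deterministic policies for a finite horizon\<close>

text \<open>Serves at horizon 0, where all policies have the same success probability.\<close>

primcorec constant_policy :: "'a \<Rightarrow> ('s, 'a) policy" where
  "constant_policy a = Transducer (return_pmf a)
     (\<lambda>(s, b). if b = a then Some (constant_policy a) else None)"

lemma constant_policy_transducers: "constant_policy a \<in> transducers"
  by (coinduction) (auto simp: ran_def dom_def split: if_splits)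

lemma constant_policy_deterministic: "deterministic (constant_policy a)"
  by (coinduction) (auto simp: ran_def dom_def split: if_splits)

text \<open>Backward induction: replace each continuation by a deterministic one at least as good,
  then play one action whose value reaches the average. The policy found depends on
  \<open>n\<close>, so letting \<open>n\<close> grow does not by itself settle
  \<open>success\<close>.\<close>

lemma exists_deterministic_success_upto_ge:
  "\<exists>\<rho>\<in>transducers. deterministic \<rho> \<and> success_upto n \<pi> \<epsilon> \<le> success_upto n \<rho> \<epsilon>"
proof (induction n arbitrary: \<pi> \<epsilon>)
  case 0
  show ?case
    using constant_policy_transducers[of undefined] constant_policy_deterministic[of undefined]
    by (auto simp: success_upto_0)
next
  case (Suc n)
  have "\<forall>s a. \<exists>\<rho>. \<rho> \<in> transducers \<and> deterministic \<rho> \<and>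
      success_upto n (succ \<pi> s a) (succ_env \<epsilon> s a) \<le> success_upto n \<rho> (succ_env \<epsilon> s a)"
    using Suc.IH by blast
  then obtain \<rho> where \<rho>: "\<And>s a. \<rho> s a \<in> transducers" "\<And>s a. deterministic (\<rho> s a)"
    "\<And>s a. success_upto n (succ \<pi> s a) (succ_env \<epsilon> s a) \<le> success_upto n (\<rho> s a) (succ_env \<epsilon> s a)"
    by metis
  obtain a where a: "(\<Sum>b\<in>UNIV. pmf (emit \<pi>) b * (\<Sum>s\<in>UNIV. pmf (emit \<epsilon>) (s, False) *
       success_upto n (succ \<pi> s b) (succ_env \<epsilon> s b)))
     \<le> (\<Sum>s\<in>UNIV. pmf (emit \<epsilon>) (s, False) * success_upto n (succ \<pi> s a) (succ_env \<epsilon> s a))"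
    using exists_ge_average[of "emit \<pi>" "\<lambda>a. \<Sum>s\<in>UNIV. pmf (emit \<epsilon>) (s, False) *
      success_upto n (succ \<pi> s a) (succ_env \<epsilon> s a)"] by blast
  have "success_upto (Suc n) \<pi> \<epsilon> \<le> signal \<epsilon> +
      (\<Sum>s\<in>UNIV. pmf (emit \<epsilon>) (s, False) * success_upto n (succ \<pi> s a) (succ_env \<epsilon> s a))"
    using a by (simp add: success_upto_Suc)
  also have "\<dots> \<le> signal \<epsilon> +
      (\<Sum>s\<in>UNIV. pmf (emit \<epsilon>) (s, False) * success_upto n (\<rho> s a) (succ_env \<epsilon> s a))"
    by (intro add_left_mono sum_mono mult_left_mono \<rho>) simp
  also have "\<dots> = success_upto (Suc n) (act a (\<lambda>s. \<rho> s a)) \<epsilon>"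
    by (simp add: success_upto_Suc_act)
  finally show ?case
    using act_deterministic[of "\<lambda>s. \<rho> s a" a] \<rho> by blast
qed

section \<open>Optimal policies and their continuations\<close>

text \<open>
  Optimality is taken among all elements of the codatatype, also those outside \<^const>\<open>transducers\<close>,
  so that the continuations \<open>succ \<pi> s a\<close> need no side condition.
\<close>

definition optimal :: "('s::finite, 'a::finite) policy \<Rightarrow> ('s, 'a) teleo_env \<Rightarrow> bool" where
  "optimal \<pi> \<epsilon> \<longleftrightarrow> (\<forall>\<rho>. success \<rho> \<epsilon> \<le> success \<pi> \<epsilon>)"

text \<open>Playing \<open>b\<close> and then continuing as \<open>\<pi>\<close> has value
  \<open>Q b\<close>, at most that of \<open>\<pi>\<close> by optimality. The value of
  \<open>\<pi>\<close> is the average of \<open>Q\<close>, so equality holds on the support.\<close>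

lemma optimal_action:
  assumes "optimal \<pi> \<epsilon>" "a \<in> set_pmf (emit \<pi>)"
  shows "success \<pi> \<epsilon> = signal \<epsilon> +
    (\<Sum>s\<in>UNIV. pmf (emit \<epsilon>) (s, False) * success (succ \<pi> s a) (succ_env \<epsilon> s a))"
proof (rule ccontr)
  define Q where "Q a = signal \<epsilon> +
    (\<Sum>s\<in>UNIV. pmf (emit \<epsilon>) (s, False) * success (succ \<pi> s a) (succ_env \<epsilon> s a))" for a
  have le: "Q b \<le> success \<pi> \<epsilon>" for b
  proof -
    have "Q b = success (act b (\<lambda>s. succ \<pi> s b)) \<epsilon>"
      by (simp add: Q_def success_act)
    then show ?thesis using assms(1) by (simp add: optimal_def)
  qed
  assume "\<not> ?thesis"
  then have "Q a < success \<pi> \<epsilon>" using le[of a] by (simp add: Q_def)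
  then have "(\<Sum>b\<in>UNIV. pmf (emit \<pi>) b * Q b) < (\<Sum>b\<in>UNIV. pmf (emit \<pi>) b * success \<pi> \<epsilon>)"
    using le assms(2)
    by (intro sum_strict_mono_ex1) (auto intro!: mult_left_mono exI[of _ a] simp: pmf_positive)
  also have "\<dots> = success \<pi> \<epsilon>"
    by (simp add: sum_distrib_right[symmetric] sum_pmf_UNIV)
  also have "(\<Sum>b\<in>UNIV. pmf (emit \<pi>) b * Q b) = success \<pi> \<epsilon>"
    by (subst success_unfold)
       (simp add: Q_def distrib_left sum.distrib sum_distrib_right[symmetric] sum_pmf_UNIV)
  finally show False by simp
qed

text \<open>A better continuation after a signal of positive probability, prefixed by
  \<open>a\<close>, would beat \<open>\<pi>\<close>.\<close>

lemma optimal_succ: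
  assumes "optimal \<pi> \<epsilon>" "a \<in> set_pmf (emit \<pi>)" "(s, False) \<in> set_pmf (emit \<epsilon>)"
  shows "optimal (succ \<pi> s a) (succ_env \<epsilon> s a)"
  unfolding optimal_def
proof (rule allI, rule ccontr)
  fix \<rho> assume "\<not> success \<rho> (succ_env \<epsilon> s a) \<le> success (succ \<pi> s a) (succ_env \<epsilon> s a)"
  then have "success \<pi> \<epsilon> < signal \<epsilon> + (\<Sum>t\<in>UNIV. pmf (emit \<epsilon>) (t, False) *
      success (if t = s then \<rho> else succ \<pi> t a) (succ_env \<epsilon> t a))"
    unfolding optimal_action[OF assms(1,2)] using assms(3)
    by (intro add_strict_left_mono sum_strict_mono_ex1)
       (auto intro!: mult_left_mono bexI[of _ s] simp: pmf_positive)
  also have "\<dots> = success (act a (\<lambda>t. if t = s then \<rho> else succ \<pi> t a)) \<epsilon>"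
    by (simp add: success_act)
  finally show False using assms(1) by (auto simp: optimal_def not_less[symmetric])
qed


section \<open>Divergent weights and the cost of delayed success\<close>

text \<open>Pick indices with \<open>r (\<kappa> i) < (1 / 2) ^ i\<close> and let \<open>c k\<close>
  count the \<open>i\<close> with \<open>\<kappa> i = k\<close>; sums weighted by \<open>c\<close>
  are then sums along \<open>\<kappa>\<close>. Indices may repeat, even infinitely often, hence the
  weights in \<open>ennreal\<close>.\<close>

lemma exists_divergent_weights:
  fixes r :: "nat \<Rightarrow> real"
  assumes "r \<longlonglongrightarrow> 0"
  shows "\<exists>c :: nat \<Rightarrow> ennreal. (\<Sum>k. c k) = top \<and> (\<Sum>k. c k * ennreal (r k)) < top"
proof -
  have "\<exists>k. r k < (1 / 2) ^ i" for i :: nat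
    using order_tendstoD(2)[OF assms, of "(1 / 2) ^ i"] by (auto simp: eventually_sequentially)
  then obtain \<kappa> where \<kappa>: "\<And>i. r (\<kappa> i) < (1 / 2) ^ i" by metis
  define c :: "nat \<Rightarrow> ennreal" where "c k = (\<Sum>i. indicator {\<kappa> i} k)" for k
  \<comment> \<open>The sum over \<open>k\<close> is read as an integral for the counting measure,
    which can be exchanged with the sum over \<open>i\<close>.\<close>
  have reindex: "(\<Sum>k. c k * g k) = (\<Sum>i. g (\<kappa> i))" for g :: "nat \<Rightarrow> ennreal"
  proof -
    have "(\<Sum>k. c k * g k) = (\<integral>\<^sup>+k. (\<Sum>i. g k * indicator {\<kappa> i} k) \<partial>count_space UNIV)"
      by (simp add: c_def nn_integral_count_space_nat mult.commute)
    also have "\<dots> = (\<Sum>i. \<integral>\<^sup>+k. g k * indicator {\<kappa> i} k \<partial>count_space UNIV)"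
      by (rule nn_integral_suminf) simp
    also have "\<dots> = (\<Sum>i. g (\<kappa> i))"
      by (simp add: nn_integral_count_space_indicator[symmetric] nn_integral_count_space_finite)
    finally show ?thesis .
  qed
  have "(\<Sum>k. c k) = (\<Sum>i::nat. 1)"
    using reindex[of "\<lambda>_. 1"] by simp
  also have "\<dots> = top"
    using nn_integral_count_space_nat[of "\<lambda>_. 1"] by simp
  finally have "(\<Sum>k. c k) = top" .
  moreover have "(\<Sum>i. ennreal (r (\<kappa> i))) \<le> (\<Sum>i. ennreal ((1 / 2) ^ i))"
    by (intro suminf_le) (auto intro!: ennreal_leI less_imp_le[OF \<kappa>])
  then have "(\<Sum>k. c k * ennreal (r k)) < top"
    unfolding reindex
    by (rule le_less_trans) (subst suminf_ennreal2, simp_all add: summable_geometric)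
  ultimately show ?thesis by blast
qed

text \<open>The index \<open>n\<close> is the number of elapsed steps, by which the weights are shifted.\<close>

definition cost ::
  "(nat \<Rightarrow> ennreal) \<Rightarrow> nat \<Rightarrow> ('s::finite, 'a::finite) policy \<Rightarrow> ('s, 'a) teleo_env \<Rightarrow> ennreal" where
  "cost c n \<pi> \<epsilon> = (\<Sum>k. c (n + k) * ennreal (success \<pi> \<epsilon> - success_upto k \<pi> \<epsilon>))"

definition next_cost ::
  "(nat \<Rightarrow> ennreal) \<Rightarrow> nat \<Rightarrow> ('s::finite, 'a::finite) policy \<Rightarrow> ('s, 'a) teleo_env \<Rightarrow> 'a \<Rightarrow> ennreal" where
  "next_cost c n \<pi> \<epsilon> a = (\<Sum>s\<in>UNIV. ennreal (pmf (emit \<epsilon>) (s, False)) *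
     cost c (Suc n) (succ \<pi> s a) (succ_env \<epsilon> s a))"

lemma suminf_mult_sum_ennreal:
  fixes c :: "nat \<Rightarrow> ennreal"
  shows "(\<Sum>k. c k * (\<Sum>x\<in>A. p x * f x k)) = (\<Sum>x\<in>A. p x * (\<Sum>k. c k * f x k))"
proof -
  have "(\<Sum>k. c k * (\<Sum>x\<in>A. p x * f x k)) = (\<Sum>k. \<Sum>x\<in>A. p x * (c k * f x k))"
    by (simp only: sum_distrib_left mult.left_commute)
  also have "\<dots> = (\<Sum>x\<in>A. p x * (\<Sum>k. c k * f x k))"
    by (subst suminf_sum) simp_all
  finally show ?thesis .
qed

text \<open>The condition on \<open>f\<close> is restricted to nonzero weights because optimality
  passes only to continuations of positive probability.\<close>

lemma ennreal_sum_mult: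
  assumes "\<And>x. x \<in> A \<Longrightarrow> 0 \<le> p x" "\<And>x. x \<in> A \<Longrightarrow> p x \<noteq> 0 \<Longrightarrow> 0 \<le> f x"
  shows "ennreal (\<Sum>x\<in>A. p x * f x) = (\<Sum>x\<in>A. ennreal (p x) * ennreal (f x))"
proof -
  have "0 \<le> p x * f x" if "x \<in> A" for x
    using assms[OF that] by (cases "p x = 0") simp_all
  then show ?thesis
    by (subst sum_ennreal[symmetric]) (simp_all add: assms(1) ennreal_mult')
qed

text \<open>The first summand is the term \<open>k = 0\<close>. The one-step equations turn each
  later gap into an average of gaps of the continuations with \<open>k\<close> lowered by one; the
  shift to \<open>Suc n\<close> keeps the weights aligned.\<close>

lemma cost_unfold:
  "cost c n \<pi> \<epsilon> = c n * ennreal (success \<pi> \<epsilon> - signal \<epsilon>) +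
     (\<Sum>a\<in>UNIV. ennreal (pmf (emit \<pi>) a) * next_cost c n \<pi> \<epsilon> a)"
proof -
  have diff: "ennreal (success \<pi> \<epsilon> - success_upto (Suc k) \<pi> \<epsilon>) =
    (\<Sum>a\<in>UNIV. ennreal (pmf (emit \<pi>) a) * (\<Sum>s\<in>UNIV. ennreal (pmf (emit \<epsilon>) (s, False)) *
      ennreal (success (succ \<pi> s a) (succ_env \<epsilon> s a) -
               success_upto k (succ \<pi> s a) (succ_env \<epsilon> s a))))" for k
  proof -
    have nonneg: "0 \<le> (\<Sum>s\<in>UNIV. pmf (emit \<epsilon>) (s, False) *
        (success (succ \<pi> s a) (succ_env \<epsilon> s a) - success_upto k (succ \<pi> s a) (succ_env \<epsilon> s a)))" for a
      by (intro sum_nonneg mult_nonneg_nonneg) (simp_all add: success_upto_le_success)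
    have "success \<pi> \<epsilon> - success_upto (Suc k) \<pi> \<epsilon> =
      (\<Sum>a\<in>UNIV. pmf (emit \<pi>) a * (\<Sum>s\<in>UNIV. pmf (emit \<epsilon>) (s, False) *
        (success (succ \<pi> s a) (succ_env \<epsilon> s a) - success_upto k (succ \<pi> s a) (succ_env \<epsilon> s a))))"
      unfolding success_upto_Suc
      by (subst success_unfold) (simp add: sum_subtractf right_diff_distrib)
    then show ?thesis
      by (simp only: ennreal_sum_mult pmf_nonneg nonneg success_upto_le_success diff_ge_0_iff_ge)
  qed
  have "cost c n \<pi> \<epsilon> = (\<Sum>k. c (n + Suc k) * ennreal (success \<pi> \<epsilon> - success_upto (Suc k) \<pi> \<epsilon>)) +
      c n * ennreal (success \<pi> \<epsilon> - signal \<epsilon>)"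
    unfolding cost_def by (subst suminf_offset[of _ 1]) (simp_all add: success_upto_0)
  also have "(\<Sum>k. c (n + Suc k) * ennreal (success \<pi> \<epsilon> - success_upto (Suc k) \<pi> \<epsilon>)) =
      (\<Sum>a\<in>UNIV. ennreal (pmf (emit \<pi>) a) * next_cost c n \<pi> \<epsilon> a)"
    unfolding diff suminf_mult_sum_ennreal next_cost_def cost_def by simp
  finally show ?thesis by (simp add: add.commute)
qed

section \<open>Deterministic selection of cheap actions\<close>

text \<open>Such an action exists by \<open>exists_le_average\<close>. The support condition lets
  optimality pass to the continuations; the other bounds its cost by the average in
  \<open>cost_unfold\<close>.\<close>

definition cheap_action ::
  "(nat \<Rightarrow> ennreal) \<Rightarrow> nat \<Rightarrow> ('s::finite, 'a::finite) policy \<Rightarrow> ('s, 'a) teleo_env \<Rightarrow> 'a" where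
  "cheap_action c n \<pi> \<epsilon> = (SOME a. a \<in> set_pmf (emit \<pi>) \<and>
     next_cost c n \<pi> \<epsilon> a \<le> (\<Sum>b\<in>UNIV. ennreal (pmf (emit \<pi>) b) * next_cost c n \<pi> \<epsilon> b))"

lemma cheap_action:
  shows cheap_action_in_support: "cheap_action c n \<pi> \<epsilon> \<in> set_pmf (emit \<pi>)"
    and cheap_action_cost: "c n * ennreal (success \<pi> \<epsilon> - signal \<epsilon>) +
      next_cost c n \<pi> \<epsilon> (cheap_action c n \<pi> \<epsilon>) \<le> cost c n \<pi> \<epsilon>"
  using someI_ex[OF exists_le_average[of "emit \<pi>" "next_cost c n \<pi> \<epsilon>", unfolded Bex_def]]
  unfolding cheap_action_def[symmetric] cost_unfold by (auto intro: add_left_mono)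

text \<open>A policy sees \<open>s\<close> but not the success bit, so the simulated environment
  always advances along \<open>(s, False)\<close>; choices made after a success do not
  matter.\<close>

primcorec cheap_policy ::
  "(nat \<Rightarrow> ennreal) \<Rightarrow> nat \<Rightarrow> ('s::finite, 'a::finite) policy \<Rightarrow> ('s, 'a) teleo_env \<Rightarrow> ('s, 'a) policy" where
  "cheap_policy c n \<pi> \<epsilon> = Transducer (return_pmf (cheap_action c n \<pi> \<epsilon>))
     (\<lambda>(s, a). if a = cheap_action c n \<pi> \<epsilon>
       then Some (cheap_policy c (Suc n) (succ \<pi> s a) (succ_env \<epsilon> s a)) else None)"

lemma cheap_policy_transducers: "cheap_policy c n \<pi> \<epsilon> \<in> transducers"
  by (coinduction arbitrary: n \<pi> \<epsilon>) (force simp: ran_def dom_def split: if_splits)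

lemma cheap_policy_deterministic: "deterministic (cheap_policy c n \<pi> \<epsilon>)"
  by (coinduction arbitrary: n \<pi> \<epsilon>) (force simp: ran_def dom_def split: if_splits)

lemma cheap_policy_unfold:
  "cheap_policy c n \<pi> \<epsilon> = act (cheap_action c n \<pi> \<epsilon>)
     (\<lambda>s. cheap_policy c (Suc n) (succ \<pi> s (cheap_action c n \<pi> \<epsilon>))
       (succ_env \<epsilon> s (cheap_action c n \<pi> \<epsilon>)))"
  by (subst cheap_policy.code) (auto simp: act_def fun_eq_iff)

text \<open>The gaps are taken against the value of \<open>\<pi>\<close>, since the value of the
  cheap policy is not yet known. Induction on partial sums: the first term is paid explicitly, the
  others are averages of gaps of the continuations, and \<open>cheap_action_cost\<close> bounds the
  total.\<close>

lemma cheap_policy_cost: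
  assumes "optimal \<pi> \<epsilon>"
  shows "(\<Sum>j<k. c (n + j) * ennreal (success \<pi> \<epsilon> - success_upto j (cheap_policy c n \<pi> \<epsilon>) \<epsilon>))
    \<le> cost c n \<pi> \<epsilon>"
  using assms
proof (induction k arbitrary: n \<pi> \<epsilon>)
  case 0
  show ?case by simp
next
  case (Suc k)
  define a where "a = cheap_action c n \<pi> \<epsilon>"
  define \<rho> where "\<rho> s = cheap_policy c (Suc n) (succ \<pi> s a) (succ_env \<epsilon> s a)" for s
  define p where "p s = pmf (emit \<epsilon>) (s, False)" for s
  define d where "d s j = success (succ \<pi> s a) (succ_env \<epsilon> s a) - success_upto j (\<rho> s) (succ_env \<epsilon> s a)"
    for s j
  have supp: "a \<in> set_pmf (emit \<pi>)"
    unfolding a_def by (rule cheap_action_in_support)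
  have opt: "optimal (succ \<pi> s a) (succ_env \<epsilon> s a)" if "p s \<noteq> 0" for s
    using that optimal_succ[OF Suc.prems supp] by (simp add: p_def set_pmf_iff)
  have d_nonneg: "0 \<le> d s j" if "p s \<noteq> 0" for s j
    using opt[OF that] success_upto_le_success[of j "\<rho> s" "succ_env \<epsilon> s a"]
    unfolding optimal_def d_def by (meson diff_ge_0_iff_ge order_trans)
  \<comment> \<open>As \<open>a\<close> lies in the support, \<open>optimal_action\<close> expresses
    the value of \<open>\<pi>\<close> through \<open>a\<close> alone, and the immediate signals
    cancel.\<close>
  have "success \<pi> \<epsilon> - success_upto (Suc j) (cheap_policy c n \<pi> \<epsilon>) \<epsilon> = (\<Sum>s\<in>UNIV. p s * d s j)" for j
    unfolding optimal_action[OF Suc.prems supp]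
    by (subst cheap_policy_unfold)
       (simp add: success_upto_Suc_act a_def[symmetric] \<rho>_def[symmetric] d_def p_def
         right_diff_distrib sum_subtractf)
  then have diff: "ennreal (success \<pi> \<epsilon> - success_upto (Suc j) (cheap_policy c n \<pi> \<epsilon>) \<epsilon>) =
      (\<Sum>s\<in>UNIV. ennreal (p s) * ennreal (d s j))" for j
    using ennreal_sum_mult[of UNIV p "\<lambda>s. d s j"] d_nonneg by (simp add: p_def)
  have "(\<Sum>j<Suc k. c (n + j) * ennreal (success \<pi> \<epsilon> - success_upto j (cheap_policy c n \<pi> \<epsilon>) \<epsilon>)) =
      c n * ennreal (success \<pi> \<epsilon> - signal \<epsilon>) +
      (\<Sum>j<k. c (Suc n + j) * (\<Sum>s\<in>UNIV. ennreal (p s) * ennreal (d s j)))"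
    by (simp add: sum.lessThan_Suc_shift success_upto_0 diff del: sum.lessThan_Suc)
  also have "(\<Sum>j<k. c (Suc n + j) * (\<Sum>s\<in>UNIV. ennreal (p s) * ennreal (d s j))) =
      (\<Sum>s\<in>UNIV. ennreal (p s) * (\<Sum>j<k. c (Suc n + j) * ennreal (d s j)))"
    unfolding sum_distrib_left by (subst sum.swap) (simp add: mult.left_commute)
  also have "\<dots> \<le> next_cost c n \<pi> \<epsilon> a"
    unfolding next_cost_def p_def[symmetric]
  proof (rule sum_mono)
    fix s
    show "ennreal (p s) * (\<Sum>j<k. c (Suc n + j) * ennreal (d s j))
      \<le> ennreal (p s) * cost c (Suc n) (succ \<pi> s a) (succ_env \<epsilon> s a)"
    proof (cases "p s = 0")
      case False
      then show ?thesis
        unfolding d_def \<rho>_def by (intro mult_left_mono Suc.IH opt) simp_all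
    qed simp
  qed
  finally show ?case
    using cheap_action_cost[of c n \<pi> \<epsilon>] unfolding a_def
    by (meson add_left_mono order_trans)
qed

text \<open>The negation is used twice: it makes \<open>\<pi>\<close> optimal, and it makes the gap
  \<open>d\<close> of the cheap policy positive.\<close>

lemma exists_deterministic_success_ge:
  "\<exists>\<rho>\<in>transducers. deterministic \<rho> \<and> success \<pi> \<epsilon> \<le> success \<rho> \<epsilon>"
proof (rule ccontr)
  assume "\<not> ?thesis"
  then have less: "success \<rho> \<epsilon> < success \<pi> \<epsilon>" if "\<rho> \<in> transducers" "deterministic \<rho>" for \<rho>
    using that by (meson not_le)
  \<comment> \<open>Each finite-horizon value of \<open>\<rho>\<close> is reached by a deterministic
    policy, whose success probability is below that of \<open>\<pi>\<close>.\<close>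
  have "success \<rho> \<epsilon> \<le> success \<pi> \<epsilon>" for \<rho>
  proof (rule LIMSEQ_le_const2[OF success_upto_LIMSEQ])
    have "success_upto n \<rho> \<epsilon> \<le> success \<pi> \<epsilon>" for n
      using exists_deterministic_success_upto_ge[of n \<rho> \<epsilon>] less success_upto_le_success
      by (meson less_imp_le order_trans)
    then show "\<exists>N. \<forall>n\<ge>N. success_upto n \<rho> \<epsilon> \<le> success \<pi> \<epsilon>" by blast
  qed
  then have opt: "optimal \<pi> \<epsilon>" by (simp add: optimal_def)
  have "(\<lambda>k. success \<pi> \<epsilon> - success_upto k \<pi> \<epsilon>) \<longlonglongrightarrow> 0"
    using tendsto_diff[OF tendsto_const success_upto_LIMSEQ, of "success \<pi> \<epsilon>" \<pi> \<epsilon>] by simp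
  then obtain c where c: "(\<Sum>k. c k) = top" "cost c 0 \<pi> \<epsilon> < top"
    using exists_divergent_weights unfolding cost_def by fastforce
  define d where "d = success \<pi> \<epsilon> - success (cheap_policy c 0 \<pi> \<epsilon>) \<epsilon>"
  have "0 < d"
    using less[OF cheap_policy_transducers cheap_policy_deterministic] by (simp add: d_def)
  \<comment> \<open>Every gap of the cheap policy is at least \<open>d\<close>, so weights with
    infinite sum force an infinite cost.\<close>
  have "(\<Sum>j. c j * ennreal d) \<le> cost c 0 \<pi> \<epsilon>"
  proof (rule suminf_le_const)
    fix k
    have "(\<Sum>j<k. c j * ennreal d) \<le>
        (\<Sum>j<k. c (0 + j) * ennreal (success \<pi> \<epsilon> - success_upto j (cheap_policy c 0 \<pi> \<epsilon>) \<epsilon>))"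
      unfolding d_def
      by (intro sum_mono) (auto intro!: mult_left_mono ennreal_leI success_upto_le_success)
    also have "\<dots> \<le> cost c 0 \<pi> \<epsilon>" by (rule cheap_policy_cost[OF opt])
    finally show "(\<Sum>j<k. c j * ennreal d) \<le> cost c 0 \<pi> \<epsilon>" .
  qed simp
  moreover have "(\<Sum>j. c j * ennreal d) = top"
    using \<open>0 < d\<close> by (simp add: c(1) ennreal_top_mult)
  ultimately show False using c(2) by (simp add: top_unique)
qed

section \<open>The environment that specifies a deterministic policy\<close>

text \<open>The state \<^const>\<open>None\<close> records that the actions have disagreed with the given policy.\<close>

primcorec guard :: "('s::finite, 'a::finite) policy option \<Rightarrow> ('s, 'a) teleo_env" where
  "guard x = Transducer
     (case x of None \<Rightarrow> return_pmf (undefined, False) | Some _ \<Rightarrow> pmf_of_set UNIV)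
     (\<lambda>(a, s, g). case x of
        None \<Rightarrow> if (s, g) = (undefined, False) then Some (guard None) else None
      | Some \<pi> \<Rightarrow> Some (guard (if emit \<pi> = return_pmf a then Some (succ \<pi> s a) else None)))"

lemma guard_None:
  "emit (guard None) = return_pmf (undefined, False)"
  "step (guard None) (a, (s, g)) = (if (s, g) = (undefined, False) then Some (guard None) else None)"
  by simp_all

lemma guard_Some:
  "emit (guard (Some \<pi>)) = pmf_of_set UNIV"
  "step (guard (Some \<pi>)) (a, (s, g)) =
    Some (guard (if emit \<pi> = return_pmf a then Some (succ \<pi> s a) else None))"
  by simp_all

lemma guard_transducers:
  fixes x :: "('s::finite, 'a::finite) policy option"
  shows "guard x \<in> transducers"
proof -
  have dom: "dom (step (guard y)) = UNIV \<times> set_pmf (emit (guard y))"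
    for y :: "('s, 'a) policy option"
    by (cases y) (auto simp: dom_def split: if_splits)
  have ran: "\<exists>z. \<epsilon> = guard z" if "\<epsilon> \<in> ran (step (guard y))"
    for \<epsilon> and y :: "('s, 'a) policy option"
    using that by (cases y) (auto simp: ran_def split: if_splits)
  show ?thesis
    by (coinduction arbitrary: x) (metis dom ran)
qed

lemma success_guard_None: "success \<pi> (guard None) = 0"
proof -
  have "success_upto n \<pi> (guard None) = 0" for n
  proof (induction n arbitrary: \<pi>)
    case 0
    show ?case by (simp add: success_upto_0 signal_def guard_None pmf_return)
  next
    case (Suc n)
    \<comment> \<open>For \<open>s\<close> other than \<open>undefined\<close> the step is outside
      its domain, but there the coefficient vanishes.\<close>
    have zero: "pmf (emit (guard None)) (s, False) *
        success_upto n (succ \<pi> s a) (succ_env (guard None) s a) = 0" for s a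
      using Suc.IH by (cases "s = undefined") (simp_all add: guard_None pmf_return)
    then show ?case
      unfolding success_upto_Suc zero
      by (simp add: signal_def guard_None pmf_return del: guard.simps)
  qed
  then show ?thesis by (simp add: success_def)
qed

lemma pmf_guard_Some: "pmf (emit (guard (Some \<pi>))) x = 1 / (2 * CARD('s))"
  for \<pi> :: "('s::finite, 'a::finite) policy"
proof -
  have "CARD('s \<times> bool) = 2 * CARD('s)"
    using card_cartesian_product[of "UNIV :: 's set" "UNIV :: bool set"] by simp
  then show ?thesis by (simp add: pmf_of_set)
qed

lemma signal_guard_Some: "signal (guard (Some \<pi>)) = 1 / 2"
  by (simp add: signal_def pmf_guard_Some del: guard.simps)

text \<open>The first signal succeeds with probability 1/2. The divisor combines the other half with
  the uniform choice of \<open>s\<close>; a disagreeing action contributes 0 by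
  \<open>success_guard_None\<close>.\<close>

lemma success_guard_Some:
  "success \<pi>' (guard (Some \<pi>)) = 1 / 2 + (\<Sum>a\<in>UNIV. pmf (emit \<pi>') a *
     (if emit \<pi> = return_pmf a
      then (\<Sum>s\<in>UNIV. success (succ \<pi>' s a) (guard (Some (succ \<pi> s a)))) / (2 * CARD('s))
      else 0))"
  for \<pi> \<pi>' :: "('s::finite, 'a::finite) policy"
proof -
  have "success (succ \<pi>' s a) (succ_env (guard (Some \<pi>)) s a) =
      (if emit \<pi> = return_pmf a then success (succ \<pi>' s a) (guard (Some (succ \<pi> s a))) else 0)"
    for s a
    by (simp add: guard_Some success_guard_None del: guard.simps)
  then show ?thesis
    by (subst success_unfold)
       (auto simp: signal_guard_Some pmf_guard_Some sum_divide_distrib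
         simp del: guard.simps intro!: sum.cong)
qed

section \<open>Certain success against the guard characterizes the policy\<close>

lemma dom_step: "\<pi> \<in> transducers \<Longrightarrow> dom (step \<pi>) = UNIV \<times> set_pmf (emit \<pi>)"
  by (erule transducers.cases) simp

lemma step_transducer:
  assumes "\<pi> \<in> transducers" "a \<in> set_pmf (emit \<pi>)"
  shows "step \<pi> (s, a) = Some (succ \<pi> s a)" "succ \<pi> s a \<in> transducers"
proof -
  note dom = dom_step[OF assms(1)]
  have ran: "\<forall>\<pi>'\<in>ran (step \<pi>). \<pi>' \<in> transducers"
    using assms(1) by (rule transducers.cases) simp
  show "step \<pi> (s, a) = Some (succ \<pi> s a)"
    using assms(2) dom by (metis SigmaI UNIV_I domD option.sel)
  then show "succ \<pi> s a \<in> transducers"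
    using ran by (blast intro: ranI)
qed

lemma step_deterministic:
  assumes "\<pi> \<in> transducers" "deterministic \<pi>"
  obtains a where "emit \<pi> = return_pmf a"
    "\<And>s. succ \<pi> s a \<in> transducers" "\<And>s. deterministic (succ \<pi> s a)"
proof -
  obtain a where a: "emit \<pi> = return_pmf a" and ran: "\<forall>\<pi>'\<in>ran (step \<pi>). deterministic \<pi>'"
    using assms(2) by (rule deterministic.cases) blast
  have "step \<pi> (s, a) = Some (succ \<pi> s a)" "succ \<pi> s a \<in> transducers" for s
    using step_transducer[OF assms(1)] by (simp_all add: a)
  then show ?thesis
    using that a ran by (meson ranI)
qed

text \<open>Each round halves the probability of no success so far. The exponent is
  \<open>Suc n\<close> because the first signal already succeeds with probability 1/2.\<close>

lemma success_guard_self: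
  assumes "\<pi> \<in> transducers" "deterministic \<pi>"
  shows "success \<pi> (guard (Some \<pi>)) = 1"
proof (rule antisym[OF success_le_1])
  have ge: "1 - (1 / 2) ^ Suc n \<le> success \<pi> (guard (Some \<pi>))" for n
    using assms
  proof (induction n arbitrary: \<pi>)
    case 0
    show ?case
      using success_upto_le_success[of 0 \<pi> "guard (Some \<pi>)"]
      by (simp add: success_upto_0 signal_guard_Some)
  next
    case (Suc n)
    obtain a where a: "emit \<pi> = return_pmf a"
      "\<And>s. succ \<pi> s a \<in> transducers" "\<And>s. deterministic (succ \<pi> s a)"
      using step_deterministic[OF Suc.prems] by metis
    have "(\<Sum>s::'a\<in>UNIV. 1 - (1 / 2) ^ Suc n) \<le>
        (\<Sum>s\<in>UNIV. success (succ \<pi> s a) (guard (Some (succ \<pi> s a))))"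
      by (intro sum_mono Suc.IH a)
    then show ?case
      by (subst success_guard_Some) (simp add: a(1) sum_pmf_return field_simps)
  qed
  have "(\<lambda>n. 1 - (1 / 2 :: real) ^ Suc n) \<longlonglongrightarrow> 1 - 0"
    by (intro tendsto_intros LIMSEQ_Suc LIMSEQ_realpow_zero) simp_all
  then show "1 \<le> success \<pi> (guard (Some \<pi>))"
    using ge by (intro LIMSEQ_le_const2) auto
qed

text \<open>Success 1 means that the probability of \<open>a\<close> times the sum of the
  continuation values \<open>F s\<close> is \<open>CARD('s)\<close>. All these factors are at most
  1, so each equals 1.\<close>

lemma success_guard_eq_1D:
  fixes \<pi> \<pi>' :: "('s::finite, 'a::finite) policy"
  assumes "emit \<pi> = return_pmf a" "success \<pi>' (guard (Some \<pi>)) = 1"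
  shows "emit \<pi>' = return_pmf a" "success (succ \<pi>' s a) (guard (Some (succ \<pi> s a))) = 1"
proof -
  define F where "F s = success (succ \<pi>' s a) (guard (Some (succ \<pi> s a)))" for s
  have F: "F s \<le> 1" for s by (simp add: F_def success_le_1)
  have sum_F: "sum F UNIV \<le> CARD('s)"
    using sum_mono[of UNIV F "\<lambda>_. 1"] F by simp
  have "pmf (emit \<pi>') b * (if emit \<pi> = return_pmf b
      then (\<Sum>s\<in>UNIV. success (succ \<pi>' s b) (guard (Some (succ \<pi> s b)))) / (2 * CARD('s)) else 0) =
      (if b = a then pmf (emit \<pi>') b * (sum F UNIV / (2 * CARD('s))) else 0)" for b
  proof (cases "b = a")
    case True
    have "sum F UNIV = (\<Sum>s\<in>UNIV. success (succ \<pi>' s a) (guard (Some (succ \<pi> s a))))"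
      by (intro sum.cong refl F_def)
    then show ?thesis by (simp only: True assms(1) simp_thms if_True)
  next
    case False
    then show ?thesis by (auto simp: assms(1))
  qed
  then have "success \<pi>' (guard (Some \<pi>)) = 1 / 2 +
      (\<Sum>b\<in>UNIV. if b = a then pmf (emit \<pi>') b * (sum F UNIV / (2 * CARD('s))) else 0)"
    by (subst success_guard_Some) (simp only:)
  also have "\<dots> = 1 / 2 + pmf (emit \<pi>') a * (sum F UNIV / (2 * CARD('s)))"
    by (subst sum.delta) simp_all
  finally have eq: "pmf (emit \<pi>') a * sum F UNIV = CARD('s)"
    using assms(2) by (simp add: field_simps)
  have "pmf (emit \<pi>') a * sum F UNIV \<le> pmf (emit \<pi>') a * CARD('s)"
    using sum_F by (intro mult_left_mono) simp_all
  then have "1 \<le> pmf (emit \<pi>') a" using eq by simp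
  then have p: "pmf (emit \<pi>') a = 1" using pmf_le_1[of "emit \<pi>'" a] by simp
  then show "emit \<pi>' = return_pmf a"
    using measure_pmf.prob_eq_1[of "{a}" "emit \<pi>'"]
    by (auto simp: measure_pmf_single AE_measure_pmf_iff simp flip: set_pmf_subset_singleton)
  have "(\<Sum>s\<in>UNIV. 1 - F s) = 0"
    using eq by (simp add: p sum_subtractf)
  then have "1 - F s = 0"
    using F by (subst (asm) sum_nonneg_eq_0_iff) auto
  then show "success (succ \<pi>' s a) (guard (Some (succ \<pi> s a))) = 1"
    by (simp add: F_def)
qed

text \<open>Coinduction: by \<open>success_guard_eq_1D\<close>, certain success forces equal
  emissions and is inherited by the continuations.\<close>

lemma success_guard_unique:
  fixes \<pi> \<pi>' :: "('s::finite, 'a::finite) policy"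
  assumes "\<pi> \<in> transducers" "deterministic \<pi>" "\<pi>' \<in> transducers"
    "success \<pi>' (guard (Some \<pi>)) = 1"
  shows "\<pi>' = \<pi>"
proof -
  define R :: "('s, 'a) policy \<Rightarrow> ('s, 'a) policy \<Rightarrow> bool" where
    "R \<sigma>' \<sigma> \<longleftrightarrow> \<sigma> \<in> transducers \<and> deterministic \<sigma> \<and> \<sigma>' \<in> transducers \<and>
      success \<sigma>' (guard (Some \<sigma>)) = 1" for \<sigma>' \<sigma>
  have "R \<pi>' \<pi>" using assms by (simp add: R_def)
  then show ?thesis
  proof (rule transducer.coinduct)
    fix \<sigma>' \<sigma> assume R: "R \<sigma>' \<sigma>"
    then have \<sigma>: "\<sigma> \<in> transducers" "deterministic \<sigma>" "\<sigma>' \<in> transducers"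
      and success: "success \<sigma>' (guard (Some \<sigma>)) = 1"
      unfolding R_def by blast+
    obtain a where a: "emit \<sigma> = return_pmf a"
      "\<And>s. succ \<sigma> s a \<in> transducers" "\<And>s. deterministic (succ \<sigma> s a)"
      using step_deterministic[OF \<sigma>(1,2)] by metis
    note a' = success_guard_eq_1D[OF a(1) success]
    \<comment> \<open>Off the common action both step maps are undefined, so equality there rests on
      the domain condition.\<close>
    have none: "step \<rho> (s, b) = None" if "\<rho> \<in> transducers" "emit \<rho> = return_pmf a" "b \<noteq> a"
      for \<rho> :: "('s, 'a) policy" and s b
    proof -
      have "(s, b) \<notin> dom (step \<rho>)"
        using that(2,3) by (simp add: dom_step[OF that(1)])
      then show ?thesis by (simp add: domIff)
    qed
    have "rel_option R (step \<sigma>' (s, b)) (step \<sigma> (s, b))" for s b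
    proof (cases "b = a")
      case True
      have step': "step \<sigma>' (s, a) = Some (succ \<sigma>' s a)" "succ \<sigma>' s a \<in> transducers"
        using step_transducer[OF \<sigma>(3), of a s] a'(1) by simp_all
      have step: "step \<sigma> (s, a) = Some (succ \<sigma> s a)"
        using step_transducer[OF \<sigma>(1), of a s] a(1) by simp
      have "R (succ \<sigma>' s a) (succ \<sigma> s a)"
        unfolding R_def using a(2,3) step'(2) a'(2) by blast
      then have "rel_option R (Some (succ \<sigma>' s a)) (Some (succ \<sigma> s a))" by simp
      then show ?thesis
        by (simp only: True step'(1)[symmetric] step[symmetric])
    next
      case False
      then show ?thesis
        using none[OF \<sigma>(1) a(1)] none[OF \<sigma>(3) a'(1)] by simp
    qed
    then show "emit \<sigma>' = emit \<sigma> \<and> rel_fun (=) (rel_option R) (step \<sigma>') (step \<sigma>)"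
      using a(1) a'(1) by (simp add: rel_fun_def split_paired_All)
  qed
qed

theorem proposition6p4p5:
  fixes T :: "('s::finite, 'a::finite) policy set" and \<pi> :: "('s, 'a) policy"
  assumes "T \<subseteq> transducers"
    and "{\<pi>' \<in> transducers. deterministic \<pi>'} \<subseteq> T"
    and "\<pi> \<in> T"
  shows "deterministic \<pi> \<longleftrightarrow> teleo_specifiable T \<pi>"
proof
  assume det: "deterministic \<pi>"
  have \<pi>: "\<pi> \<in> transducers" using assms by blast
  have "\<pi>' = \<pi>" if "\<pi>' \<in> T" "success \<pi> (guard (Some \<pi>)) \<le> success \<pi>' (guard (Some \<pi>))" for \<pi>'
  proof (rule success_guard_unique[OF \<pi> det])
    show "\<pi>' \<in> transducers" using that assms by blast
    show "success \<pi>' (guard (Some \<pi>)) = 1"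
      using that(2) success_le_1[of \<pi>' "guard (Some \<pi>)"] by (simp add: success_guard_self[OF \<pi> det])
  qed
  then show "teleo_specifiable T \<pi>"
    unfolding teleo_specifiable_def using guard_transducers by blast
next
  assume "teleo_specifiable T \<pi>"
  then obtain \<epsilon> where \<epsilon>: "\<And>\<pi>'. \<pi>' \<in> T \<Longrightarrow> success \<pi> \<epsilon> \<le> success \<pi>' \<epsilon> \<Longrightarrow> \<pi>' = \<pi>"
    unfolding teleo_specifiable_def by blast
  \<comment> \<open>\<open>\<rho>\<close> belongs to \<open>T\<close> and does at least as well as
    \<open>\<pi>\<close>, so it is \<open>\<pi>\<close>.\<close>
  obtain \<rho> where "\<rho> \<in> transducers" "deterministic \<rho>" "success \<pi> \<epsilon> \<le> success \<rho> \<epsilon>"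
    using exists_deterministic_success_ge by blast
  then show "deterministic \<pi>" using \<epsilon>[of \<rho>] assms(2) by blast
qed

end
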